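(* Let $G=(V,A)$ be a connected directed graph with node-arc incidence matrix $A$, let $b\in\mathbb{Z}^n$ with $\mathbb{1}^Tb=0$ and $c\in\mathbb{Z}^m$, let $0<\varepsilon<1$, let $\tilde b\in\mathbb{R}^n$, $\tilde c\in\mathbb{R}^m$ with $\|b-\tilde b\|_1\le 2\varepsilon$ and $\|c-\tilde c\|_1\le\varepsilon$, and let $T$ be a spanning tree of $G$. Then: (a) if the unique primal tree solution w.r.t. $T$ for $(G,\tilde b,\tilde c)$ is primal feasible, then the unique primal tree solution w.r.t. $T$ for $(G,b,c)$ is primal feasible; (b) if the dual tree solution w.r.t. $T$ for $(G,\tilde b,\tilde c)$ is dual feasible, then the dual tree solution w.r.t. $T$ for $(G,b,c)$ is dual feasible; (c) if $T$ is optimal for $(G,\tilde b,\tilde c)$ (i.e. its primal and dual tree solutions are both feasible), then $T$ is optimal for $(G,b,c)$.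
   Context: The node-arc incidence matrix has a column per arc $(v,w)$ with $-1$ in row $v$, $+1$ in row $w$, zeros elsewhere. For an instance $(G,b',c')$ (LP pair $\min\{c'^Tx:Ax=b',x\ge0\}$, $\max\{b'^Ty:A^Ty+s=c',s\ge0\}$) and a spanning tree $T$, a primal tree solution is $x\in\mathbb{R}^m$ with $Ax=b'$ and $x_a=0$ for all $a\notin T$; it is primal feasible if $x\ge0$. A dual tree solution is $(y,s)$ with $A^Ty+s=c'$ and $s_a=0$ for all $a\in T$ (unique in $s$); it is dual feasible if $s\ge0$. *)

theory Defs
  imports Complex_Main "HOL-Library.FuncSet" "Graph_Theory.Digraph_Component"
begin

(* A loop, for which the two prescribed entries fall on the same row, gets the zero column. *)
definition incidence :: "('v, 'e) pre_digraph \<Rightarrow> 'v \<Rightarrow> 'e \<Rightarrow> real" where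
  "incidence G v a = of_bool (v = head G a) - of_bool (v = tail G a)"

(* The multigraph in which every arc a may be traversed forwards, as (a, True),
   and backwards, as (a, False). Unlike mk_symmetric it keeps the identity of the
   arcs, so that parallel and antiparallel arcs stay distinguishable. *)
definition bidirect :: "('v, 'e) pre_digraph \<Rightarrow> ('v, 'e \<times> bool) pre_digraph" where
  "bidirect G = \<lparr> verts = verts G, arcs = arcs G \<times> UNIV,
     tail = (\<lambda>(a, fwd). if fwd then tail G a else head G a),
     head = (\<lambda>(a, fwd). if fwd then head G a else tail G a) \<rparr>"

(* Distinctness of the underlying arcs excludes going back and forth along one arc. *)
definition undirected_cycle :: "('v, 'e) pre_digraph \<Rightarrow> ('e \<times> bool) list \<Rightarrow> bool" where
  "undirected_cycle G p \<longleftrightarrow> pre_digraph.cycle (bidirect G) p \<and> distinct (map fst p)"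

(* The library's forest and spanning_tree only exclude directed cycles (and so count the
   two orientations of an edge of a symmetric digraph as a cycle); a spanning tree here
   is a tree in the undirected sense, given by its set of arcs. *)
definition spanning_tree_arcs :: "('v, 'e) pre_digraph \<Rightarrow> 'e set \<Rightarrow> bool" where
  "spanning_tree_arcs G T \<longleftrightarrow>
     spanning (G\<lparr>arcs := T\<rparr>) G \<and>
     Digraph_Component.connected (G\<lparr>arcs := T\<rparr>) \<and>
     \<not> (\<exists>p. undirected_cycle (G\<lparr>arcs := T\<rparr>) p)"

(* Vectors indexed by a finite set S are elements of S \<rightarrow>\<^sub>E UNIV, so that
   equality of vectors, and hence uniqueness, only concerns their entries in S. *)
definition primal_tree_solution ::
    "('v, 'e) pre_digraph \<Rightarrow> ('v \<Rightarrow> real) \<Rightarrow> 'e set \<Rightarrow> ('e \<Rightarrow> real) \<Rightarrow> bool" where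
  "primal_tree_solution G b T x \<longleftrightarrow>
     x \<in> arcs G \<rightarrow>\<^sub>E UNIV \<and>
     (\<forall>v\<in>verts G. (\<Sum>a\<in>arcs G. incidence G v a * x a) = b v) \<and>
     (\<forall>a\<in>arcs G - T. x a = 0)"

definition dual_tree_solution ::
    "('v, 'e) pre_digraph \<Rightarrow> ('e \<Rightarrow> real) \<Rightarrow> 'e set \<Rightarrow> ('v \<Rightarrow> real) \<Rightarrow> ('e \<Rightarrow> real) \<Rightarrow> bool" where
  "dual_tree_solution G c T y s \<longleftrightarrow>
     y \<in> verts G \<rightarrow>\<^sub>E UNIV \<and> s \<in> arcs G \<rightarrow>\<^sub>E UNIV \<and>
     (\<forall>a\<in>arcs G. (\<Sum>v\<in>verts G. incidence G v a * y v) + s a = c a) \<and>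
     (\<forall>a\<in>T. s a = 0)"

(* "The unique primal tree solution is primal feasible": this includes that there is
   exactly one primal tree solution. *)
definition primal_tree_feasible ::
    "('v, 'e) pre_digraph \<Rightarrow> ('v \<Rightarrow> real) \<Rightarrow> 'e set \<Rightarrow> bool" where
  "primal_tree_feasible G b T \<longleftrightarrow>
     (\<exists>!x. primal_tree_solution G b T x) \<and>
     (\<forall>x. primal_tree_solution G b T x \<longrightarrow> (\<forall>a\<in>arcs G. 0 \<le> x a))"

(* Only s is unique; y may be shifted by a constant. *)
definition dual_tree_feasible ::
    "('v, 'e) pre_digraph \<Rightarrow> ('e \<Rightarrow> real) \<Rightarrow> 'e set \<Rightarrow> bool" where
  "dual_tree_feasible G c T \<longleftrightarrow>
     (\<exists>!s. \<exists>y. dual_tree_solution G c T y s) \<and>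
     (\<forall>y s. dual_tree_solution G c T y s \<longrightarrow> (\<forall>a\<in>arcs G. 0 \<le> s a))"

definition optimal_tree ::
    "('v, 'e) pre_digraph \<Rightarrow> ('v \<Rightarrow> real) \<Rightarrow> ('e \<Rightarrow> real) \<Rightarrow> 'e set \<Rightarrow> bool" where
  "optimal_tree G b c T \<longleftrightarrow> primal_tree_feasible G b T \<and> dual_tree_feasible G c T"

end

theory Submission
  imports Defs
begin

text \<open>
  Removing an arc of the tree \<open>T\<close> splits the vertices into the two sides of its fundamental cut.
  The indicator of the head side has potential difference 1 along that arc and 0 along the other
  tree arcs. Hence the entry of a primal tree solution at a tree arc is the sum of \<open>b\<close> over the
  head side, and the combination of these indicators with coefficients \<open>c\<close> is the potential of a
  dual tree solution. So tree solutions for integral data are integral. As the entries of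
  the primal perturbation sum to 0, those of one side add up to at most half of its 1-norm; so in
  passing from the perturbed data to the integral data each primal entry and each slack changes by
  at most \<open>\<epsilon> < 1\<close>, and an integer that is at least \<open>- \<epsilon>\<close> is nonnegative.
\<close>

section \<open>Rounding and 1-norm estimates\<close>

lemma of_int_nonneg_if_ge_minus:
  assumes "(x::real) \<in> \<int>" "- e \<le> x" "e < 1"
  shows "0 \<le> x"
proof -
  obtain k where k: "x = of_int k"
    using assms(1) by (auto elim: Ints_cases)
  have "- 1 < k"
    using assms k by linarith
  then show ?thesis
    using k by simp
qed

text \<open>The sums over \<open>S\<close> and over its complement are opposite, so both partial
  1-norms bound the same absolute value. This factor 2 is what allows \<open>b\<close> to be
  perturbed twice as much as \<open>c\<close>.\<close>

lemma two_abs_sum_subset_le: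
  fixes d :: "'a \<Rightarrow> real"
  assumes "finite V" "S \<subseteq> V" "sum d V = 0"
  shows "2 * \<bar>sum d S\<bar> \<le> (\<Sum>v\<in>V. \<bar>d v\<bar>)"
proof -
  have split: "sum f V = sum f S + sum f (V - S)" for f :: "'a \<Rightarrow> real"
    using assms by (simp add: sum.subset_diff)
  have "\<bar>sum d S\<bar> \<le> (\<Sum>v\<in>S. \<bar>d v\<bar>)" "\<bar>sum d (V - S)\<bar> \<le> (\<Sum>v\<in>V - S. \<bar>d v\<bar>)"
    by (rule sum_abs)+
  then show ?thesis
    using split[of d] split[of "\<lambda>v. \<bar>d v\<bar>"] assms(3) by linarith
qed

section \<open>Undirected walks as walks in \<open>bidirect\<close>\<close>

lemma bidirect_simps [simp]:
  "verts (bidirect G) = verts G"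
  "arcs (bidirect G) = arcs G \<times> UNIV"
  "tail (bidirect G) e = (if snd e then tail G (fst e) else head G (fst e))"
  "head (bidirect G) e = (if snd e then head G (fst e) else tail G (fst e))"
  by (auto simp: bidirect_def split: prod.split)

lemma arcs_ends_bidirect:
  "arcs_ends (bidirect G) = (\<Union>e\<in>arcs G. {(tail G e, head G e), (head G e, tail G e)})"
  by (force simp: arcs_ends_def arc_to_ends_def)

lemma (in wf_digraph) wf_digraph_bidirect: "wf_digraph (bidirect G)"
  by unfold_locales auto

text \<open>Connectedness is strong connectedness of \<open>mk_symmetric\<close>, which has the same
  pairs of adjacent vertices as \<open>bidirect\<close>; reachability depends only on these
  pairs.\<close>

lemma connected_imp_reachable_bidirect:
  assumes "Digraph_Component.connected G" "u \<in> verts G" "v \<in> verts G"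
  shows "u \<rightarrow>\<^sup>*\<^bsub>bidirect G\<^esub> v"
  using assms
  by (simp add: connected_def strongly_connected_def reachable_def arcs_ends_bidirect
      parcs_mk_symmetric)

text \<open>
  An arc traversed twice by a path in \<^term>\<open>bidirect G\<close> would make the path visit one of its
  ends twice.
\<close>

lemma (in wf_digraph) bidirect_apath_distinct_arcs:
  assumes "pre_digraph.apath (bidirect G) u p v"
  shows "distinct (map fst p)"
  using assms
proof (induction p arbitrary: u)
  case (Cons e p)
  interpret B: wf_digraph "bidirect G"
    by (rule wf_digraph_bidirect)
  have p: "B.apath (head (bidirect G) e) p v"
    and u: "tail (bidirect G) e \<notin> set (B.awalk_verts (head (bidirect G) e) p)"
    using Cons.prems unfolding B.apath_Cons_iff by blast+
  have "fst e \<noteq> fst e'" if "e' \<in> set p" for e'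
  proof
    assume "fst e = fst e'"
    then have "tail (bidirect G) e \<in> {tail (bidirect G) e', head (bidirect G) e'}"
      by auto
    then show False
      using u B.awalk_verts_arc1[OF that, of "head (bidirect G) e"]
        B.awalk_verts_arc2[OF B.awalkI_apath[OF p] that]
      by (metis insertE singletonD)
  qed
  then show ?case
    using Cons.IH[OF p] by auto
qed simp

section \<open>The incidence matrix and its transpose\<close>

lemma (in fin_digraph) sum_incidence_transpose:
  assumes "a \<in> arcs G"
  shows "(\<Sum>v\<in>verts G. incidence G v a * y v) = y (head G a) - y (tail G a)"
proof -
  have "(\<Sum>v\<in>verts G. incidence G v a * y v) =
      (\<Sum>v\<in>verts G. (if v = head G a then y v else 0) - (if v = tail G a then y v else 0))"
    by (rule sum.cong) (auto simp: incidence_def)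
  also have "\<dots> = y (head G a) - y (tail G a)"
    using assms by (simp add: sum_subtractf)
  finally show ?thesis .
qed

text \<open>Exchanging the two sums moves the matrix from \<open>x\<close> to \<open>y\<close>.
  Later \<open>y\<close> is a cut indicator, which isolates one entry of \<open>x\<close>, or
  constant 1, which yields the balance of the right-hand side.\<close>

lemma (in fin_digraph) sum_incidence_adjoint:
  "(\<Sum>v\<in>verts G. y v * (\<Sum>a\<in>arcs G. incidence G v a * x a)) =
    (\<Sum>a\<in>arcs G. x a * (y (head G a) - y (tail G a)))"
proof -
  have "(\<Sum>v\<in>verts G. y v * (\<Sum>a\<in>arcs G. incidence G v a * x a)) =
      (\<Sum>a\<in>arcs G. \<Sum>v\<in>verts G. x a * (incidence G v a * y v))"
    by (subst sum.swap) (simp add: sum_distrib_left mult_ac)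
  then show ?thesis
    by (simp add: sum_distrib_left[symmetric] sum_incidence_transpose)
qed

section \<open>Fundamental cuts of a spanning tree\<close>

locale tree_digraph = fin_digraph G for G :: "('v, 'e) pre_digraph" +
  fixes T :: "'e set"
  assumes spanning_tree: "spanning_tree_arcs G T"
begin

lemma tree_subset: "T \<subseteq> arcs G"
  using spanning_tree by (simp add: spanning_tree_arcs_def spanning_def subgraph_def)

lemma finite_tree: "finite T"
  using tree_subset finite_arcs by (rule finite_subset)

lemma tree_reachable:
  assumes "u \<in> verts G" "v \<in> verts G"
  shows "u \<rightarrow>\<^sup>*\<^bsub>bidirect (G\<lparr>arcs := T\<rparr>)\<^esub> v"
  using spanning_tree assms
  by (intro connected_imp_reachable_bidirect) (auto simp: spanning_tree_arcs_def)

lemma wf_digraph_subset: "S \<subseteq> T \<Longrightarrow> wf_digraph (G\<lparr>arcs := S\<rparr>)"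
  using tree_subset by unfold_locales auto

definition cut_side :: "'e \<Rightarrow> 'v set" where
  "cut_side a = {v. head G a \<rightarrow>\<^sup>*\<^bsub>bidirect (G\<lparr>arcs := T - {a}\<rparr>)\<^esub> v}"

lemma cut_side_subset: "cut_side a \<subseteq> verts G"
proof
  fix v assume v: "v \<in> cut_side a"
  interpret B: wf_digraph "bidirect (G\<lparr>arcs := T - {a}\<rparr>)"
    by (rule wf_digraph.wf_digraph_bidirect, rule wf_digraph_subset) auto
  show "v \<in> verts G"
    using v B.reachable_in_verts(2) by (auto simp: cut_side_def)
qed

lemma head_in_cut_side: "a \<in> T \<Longrightarrow> head G a \<in> cut_side a"
  using tree_subset by (auto simp: cut_side_def reachable_def)

text \<open>Otherwise a path from head to tail avoiding \<open>a\<close> would close up with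
  \<open>a\<close> to an undirected cycle in \<open>T\<close>. For a loop the path is empty and the
  cycle has length one.\<close>

lemma tail_notin_cut_side:
  assumes a: "a \<in> T"
  shows "tail G a \<notin> cut_side a"
proof
  assume tail: "tail G a \<in> cut_side a"
  let ?H = "G\<lparr>arcs := T - {a}\<rparr>" and ?K = "G\<lparr>arcs := T\<rparr>"
  interpret H: wf_digraph ?H
    by (rule wf_digraph_subset) auto
  interpret BH: wf_digraph "bidirect ?H"
    by (rule H.wf_digraph_bidirect)
  interpret K: wf_digraph ?K
    by (rule wf_digraph_subset) auto
  interpret BK: wf_digraph "bidirect ?K"
    by (rule K.wf_digraph_bidirect)
  obtain p where p: "BH.apath (head G a) p (tail G a)"
    using tail BH.reachable_apath by (auto simp: cut_side_def)
  have "subgraph (bidirect ?H) (bidirect ?K)"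
    by (auto simp: subgraph_def compatible_def BH.wf_digraph BK.wf_digraph)
  then have pK: "BK.apath (head G a) p (tail G a)"
    using p BK.subgraph_apath_imp_apath by blast
  have notin: "a \<notin> set (map fst p)"
    using p by (auto simp: BH.apath_def BH.awalk_def)
  have "BK.awalk (tail G a) ((a, True) # p) (tail G a)"
    using a pK by (simp add: BK.awalk_Cons_iff BK.apath_def)
  \<comment> \<open>Without its first vertex, the closed walk visits exactly the vertices of the
    path \<open>p\<close>.\<close>
  moreover have "distinct (tl (BK.awalk_verts (tail G a) ((a, True) # p)))"
    using pK by (simp add: BK.apath_def)
  ultimately have "BK.cycle ((a, True) # p)"
    unfolding BK.cycle_def by blast
  then have "undirected_cycle ?K ((a, True) # p)"
    using notin H.bidirect_apath_distinct_arcs[OF p] by (simp add: undirected_cycle_def)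
  then show False
    using spanning_tree by (auto simp: spanning_tree_arcs_def)
qed

text \<open>The arc \<open>e\<close> survives the removal of \<open>a\<close> and can be traversed
  in both directions.\<close>

lemma cut_side_other_arc:
  assumes "e \<in> T" "e \<noteq> a"
  shows "head G e \<in> cut_side a \<longleftrightarrow> tail G e \<in> cut_side a"
proof -
  interpret B: wf_digraph "bidirect (G\<lparr>arcs := T - {a}\<rparr>)"
    by (rule wf_digraph.wf_digraph_bidirect, rule wf_digraph_subset) auto
  have "(tail G e, head G e) \<in> arcs_ends (bidirect (G\<lparr>arcs := T - {a}\<rparr>))"
    "(head G e, tail G e) \<in> arcs_ends (bidirect (G\<lparr>arcs := T - {a}\<rparr>))"
    using assms by (auto simp: arcs_ends_bidirect)
  then show ?thesis
    unfolding cut_side_def by (auto intro: B.reachable_adj_trans)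
qed

definition cut_indicator :: "'e \<Rightarrow> 'v \<Rightarrow> real" where
  "cut_indicator a v = of_bool (v \<in> cut_side a)"

lemma cut_indicator_diff:
  assumes "a \<in> T" "e \<in> T"
  shows "cut_indicator a (head G e) - cut_indicator a (tail G e) = of_bool (e = a)"
  using assms head_in_cut_side tail_notin_cut_side cut_side_other_arc[of e a]
  by (auto simp: cut_indicator_def)

section \<open>Primal tree solutions\<close>

text \<open>Pairing the balance equations with the cut indicator of \<open>a\<close> gives the net
  flow into the head side. Other tree arcs do not cross the cut, and non-tree arcs carry no
  flow.\<close>

lemma primal_tree_solution_eq_cut_sum:
  assumes x: "primal_tree_solution G b T x" and a: "a \<in> T"
  shows "x a = (\<Sum>v\<in>cut_side a. b v)"
proof -
  have "(\<Sum>v\<in>cut_side a. b v) = (\<Sum>v\<in>verts G. cut_indicator a v * b v)"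
    using cut_side_subset
    by (simp add: cut_indicator_def sum.inter_restrict[symmetric] Int_absorb1 of_bool_def
        if_distrib[of "\<lambda>t. t * _"] cong: if_cong)
  also have "\<dots> = (\<Sum>v\<in>verts G. cut_indicator a v * (\<Sum>e\<in>arcs G. incidence G v e * x e))"
    using x by (simp add: primal_tree_solution_def)
  also have "\<dots> =
      (\<Sum>e\<in>arcs G. x e * (cut_indicator a (head G e) - cut_indicator a (tail G e)))"
    by (rule sum_incidence_adjoint)
  also have "\<dots> = (\<Sum>e\<in>arcs G. if e = a then x e else 0)"
  proof (rule sum.cong)
    fix e assume e: "e \<in> arcs G"
    show "x e * (cut_indicator a (head G e) - cut_indicator a (tail G e)) =
        (if e = a then x e else 0)"
    proof (cases "e \<in> T")
      case True
      then show ?thesis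
        using cut_indicator_diff[OF a] by simp
    next
      case False
      then show ?thesis
        using x e a by (auto simp: primal_tree_solution_def)
    qed
  qed simp
  also have "\<dots> = x a"
    using a tree_subset by auto
  finally show ?thesis ..
qed

lemma primal_tree_solution_unique:
  assumes "primal_tree_solution G b T x" "primal_tree_solution G b T x'"
  shows "x = x'"
proof (rule PiE_ext[of _ "arcs G"])
  show "x \<in> arcs G \<rightarrow>\<^sub>E UNIV" "x' \<in> arcs G \<rightarrow>\<^sub>E UNIV"
    using assms by (auto simp: primal_tree_solution_def)
  show "x a = x' a" if "a \<in> arcs G" for a
  proof (cases "a \<in> T")
    case True
    then show ?thesis
      using assms primal_tree_solution_eq_cut_sum by metis
  next
    case False
    then show ?thesis
      using assms that by (simp add: primal_tree_solution_def)
  qed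
qed

text \<open>A unit flow from \<open>u\<close> to \<open>v\<close> is built along a tree walk, one
  arc per induction step. Contributions add up, so the walk may repeat arcs.\<close>

lemma ex_tree_path_flow:
  assumes "u \<in> verts G" "v \<in> verts G"
  shows "\<exists>f :: 'e \<Rightarrow> real. (\<forall>a. a \<notin> T \<longrightarrow> f a = 0) \<and>
    (\<forall>w. (\<Sum>a\<in>arcs G. incidence G w a * f a) = of_bool (w = v) - of_bool (w = u))"
proof -
  interpret B: wf_digraph "bidirect (G\<lparr>arcs := T\<rparr>)"
    by (rule wf_digraph.wf_digraph_bidirect, rule wf_digraph_subset) auto
  from tree_reachable[OF assms] show ?thesis
  proof (induction rule: B.reachable_induct)
    case base
    show ?case
      by (intro exI[of _ "\<lambda>_. 0"]) simp
  next
    case (step v v')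
    obtain f where f0: "\<And>a. a \<notin> T \<Longrightarrow> f a = 0"
      and f: "\<And>w. (\<Sum>a\<in>arcs G. incidence G w a * f a) = of_bool (w = v) - of_bool (w = u)"
      using step.IH by blast
    obtain e where e: "e \<in> T"
      and ends: "(v, v') = (tail G e, head G e) \<or> (v, v') = (head G e, tail G e)"
      using step.hyps(2) by (auto simp: arcs_ends_bidirect)
    \<comment> \<open>An arc traversed backwards carries flow -1.\<close>
    define \<sigma> :: real where "\<sigma> = (if (v, v') = (tail G e, head G e) then 1 else - 1)"
    let ?g = "\<lambda>a. f a + (if a = e then \<sigma> else 0)"
    have "(\<Sum>a\<in>arcs G. incidence G w a * ?g a) = of_bool (w = v') - of_bool (w = u)" for w
    proof -
      have "(\<Sum>a\<in>arcs G. incidence G w a * ?g a) =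
          (\<Sum>a\<in>arcs G. incidence G w a * f a)
            + (\<Sum>a\<in>arcs G. if a = e then incidence G w a * \<sigma> else 0)"
        unfolding sum.distrib[symmetric] by (rule sum.cong) (auto simp: algebra_simps)
      also have "\<dots> = of_bool (w = v) - of_bool (w = u) + incidence G w e * \<sigma>"
        using f e tree_subset by auto
      also have "\<dots> = of_bool (w = v') - of_bool (w = u)"
        using ends by (auto simp: incidence_def \<sigma>_def)
      finally show ?thesis .
    qed
    moreover have "?g a = 0" if "a \<notin> T" for a
      using that f0 e by auto
    ultimately show ?case
      by (intro exI[of _ ?g]) blast
  qed
qed

text \<open>Superposition: for each vertex \<open>v\<close>, \<open>b v\<close> units are sent from
  a fixed root \<open>r\<close> to \<open>v\<close> along the tree.\<close>

lemma ex_primal_tree_solution: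
  assumes "(\<Sum>v\<in>verts G. b v) = 0"
  shows "\<exists>x. primal_tree_solution G b T x"
proof -
  obtain r where r: "r \<in> verts G"
    using spanning_tree
    by (auto simp: spanning_tree_arcs_def connected_def strongly_connected_def)
  have "\<forall>v\<in>verts G. \<exists>f :: 'e \<Rightarrow> real. (\<forall>a. a \<notin> T \<longrightarrow> f a = 0) \<and>
    (\<forall>w. (\<Sum>a\<in>arcs G. incidence G w a * f a) = of_bool (w = v) - of_bool (w = r))"
    using ex_tree_path_flow r by blast
  then obtain f :: "'v \<Rightarrow> 'e \<Rightarrow> real" where f0: "\<And>v a. v \<in> verts G \<Longrightarrow> a \<notin> T \<Longrightarrow> f v a = 0"
    and f: "\<And>v w. v \<in> verts G \<Longrightarrow>
      (\<Sum>a\<in>arcs G. incidence G w a * f v a) = of_bool (w = v) - of_bool (w = r)"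
    by metis
  define x where "x = restrict (\<lambda>a. \<Sum>v\<in>verts G. b v * f v a) (arcs G)"
  have "(\<Sum>a\<in>arcs G. incidence G w a * x a) = b w" if "w \<in> verts G" for w
  proof -
    have "(\<Sum>a\<in>arcs G. incidence G w a * x a) =
        (\<Sum>a\<in>arcs G. \<Sum>v\<in>verts G. b v * (incidence G w a * f v a))"
      by (simp add: x_def sum_distrib_left mult_ac)
    also have "\<dots> = (\<Sum>v\<in>verts G. b v * (\<Sum>a\<in>arcs G. incidence G w a * f v a))"
      by (subst sum.swap) (simp add: sum_distrib_left)
    also have "\<dots> = (\<Sum>v\<in>verts G. (if w = v then b v else 0) - b v * of_bool (w = r))"
      by (rule sum.cong) (auto simp: f)
    \<comment> \<open>What leaves the root is the total of \<open>b\<close>, which is zero.\<close>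
    also have "\<dots> = b w"
      using that assms by (simp add: sum_subtractf sum_distrib_right[symmetric])
    finally show ?thesis .
  qed
  then have "primal_tree_solution G b T x"
    using f0 by (auto simp: primal_tree_solution_def x_def)
  then show ?thesis
    by blast
qed

text \<open>The constant potential 1 has no differences along arcs. This supplies the balance of the
  perturbed \<open>b'\<close> from the existence of its tree solution.\<close>

lemma primal_tree_solution_sum_zero:
  assumes "primal_tree_solution G b T x"
  shows "(\<Sum>v\<in>verts G. b v) = 0"
  using assms sum_incidence_adjoint[of "\<lambda>_. 1" x] by (simp add: primal_tree_solution_def)

lemma primal_tree_feasible_perturb:
  assumes sum_b: "(\<Sum>v\<in>verts G. b v) = 0" and int_b: "\<And>v. v \<in> verts G \<Longrightarrow> b v \<in> \<int>"
    and near: "(\<Sum>v\<in>verts G. \<bar>b v - b' v\<bar>) \<le> 2 * \<epsilon>" and "\<epsilon> < 1"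
    and feasible: "primal_tree_feasible G b' T"
  shows "primal_tree_feasible G b T"
proof -
  obtain x' where x': "primal_tree_solution G b' T x'"
    and x'_nonneg: "\<And>a. a \<in> arcs G \<Longrightarrow> 0 \<le> x' a"
    using feasible by (auto simp: primal_tree_feasible_def)
  have "0 \<le> x a" if x: "primal_tree_solution G b T x" and a: "a \<in> arcs G" for x a
  proof (cases "a \<in> T")
    case False
    then show ?thesis
      using x a by (simp add: primal_tree_solution_def)
  next
    case True
    have "(\<Sum>v\<in>verts G. b v - b' v) = 0"
      using sum_b primal_tree_solution_sum_zero[OF x'] by (simp add: sum_subtractf)
    \<comment> \<open>\<open>b - b'\<close> is balanced, so the bound \<open>2 * \<epsilon>\<close>
      on its 1-norm is halved on one side of the cut.\<close>
    from two_abs_sum_subset_le[OF finite_verts cut_side_subset[of a] this]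
    have "\<bar>\<Sum>v\<in>cut_side a. b v - b' v\<bar> \<le> \<epsilon>"
      using near by linarith
    moreover have "(\<Sum>v\<in>cut_side a. b v - b' v) = x a - x' a"
      using True x x' by (simp add: primal_tree_solution_eq_cut_sum sum_subtractf)
    ultimately have "- \<epsilon> \<le> x a"
      using x'_nonneg[OF a] by linarith
    moreover have "x a \<in> \<int>"
      using True x int_b cut_side_subset[of a]
      by (auto simp: primal_tree_solution_eq_cut_sum intro!: Ints_sum)
    ultimately show ?thesis
      using \<open>\<epsilon> < 1\<close> by (intro of_int_nonneg_if_ge_minus)
  qed
  then show ?thesis
    using ex_primal_tree_solution[OF sum_b] primal_tree_solution_unique
    unfolding primal_tree_feasible_def by blast
qed

section \<open>Dual tree solutions\<close>

definition tree_potential :: "('e \<Rightarrow> real) \<Rightarrow> 'v \<Rightarrow> real" where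
  "tree_potential c v = (\<Sum>a\<in>T. c a * cut_indicator a v)"

definition tree_slack :: "('e \<Rightarrow> real) \<Rightarrow> 'e \<Rightarrow> real" where
  "tree_slack c = restrict (\<lambda>a. c a - (tree_potential c (head G a) - tree_potential c (tail G a)))
    (arcs G)"

lemma tree_potential_diff:
  "tree_potential c v - tree_potential c w =
    (\<Sum>a\<in>T. c a * (cut_indicator a v - cut_indicator a w))"
  by (simp add: tree_potential_def sum_subtractf right_diff_distrib)

text \<open>Among the cut indicators of tree arcs only that of \<open>e\<close> changes along
  \<open>e\<close>, so the potential rises by exactly \<open>c e\<close>.\<close>

lemma tree_slack_zero:
  assumes "e \<in> T"
  shows "tree_slack c e = 0"
proof -
  have "tree_potential c (head G e) - tree_potential c (tail G e) =
      (\<Sum>a\<in>T. if e = a then c a else 0)"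
    unfolding tree_potential_diff using assms
    by (intro sum.cong) (auto simp: cut_indicator_diff)
  then show ?thesis
    using assms tree_subset finite_tree by (auto simp: tree_slack_def)
qed

lemma dual_tree_solution_tree_slack:
  "dual_tree_solution G c T (restrict (tree_potential c) (verts G)) (tree_slack c)"
proof -
  have "(\<Sum>v\<in>verts G. incidence G v a * restrict (tree_potential c) (verts G) v) +
      tree_slack c a = c a" if "a \<in> arcs G" for a
    unfolding sum_incidence_transpose[OF that] using that by (simp add: tree_slack_def)
  then show ?thesis
    using tree_slack_zero by (auto simp: dual_tree_solution_def tree_slack_def)
qed

text \<open>Both slacks vanish on \<open>T\<close>, so \<open>y - y'\<close> does not change along
  tree arcs and is constant since the tree connects all vertices. The constant cancels in every
  potential difference.\<close>

lemma dual_tree_solution_slack_unique: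
  assumes ys: "dual_tree_solution G c T y s" and ys': "dual_tree_solution G c T y' s'"
  shows "s = s'"
proof -
  interpret B: wf_digraph "bidirect (G\<lparr>arcs := T\<rparr>)"
    by (rule wf_digraph.wf_digraph_bidirect, rule wf_digraph_subset) auto
  have eq: "y (head G a) - y (tail G a) + s a = y' (head G a) - y' (tail G a) + s' a"
    if "a \<in> arcs G" for a
    using ys ys' that by (simp add: dual_tree_solution_def sum_incidence_transpose)
  have tree_eq: "y (head G a) - y' (head G a) = y (tail G a) - y' (tail G a)" if "a \<in> T" for a
  proof -
    have "s a = 0" "s' a = 0"
      using ys ys' that by (auto simp: dual_tree_solution_def)
    then show ?thesis
      using eq[of a] that tree_subset by auto
  qed
  have const: "y u - y' u = y v - y' v" if "u \<in> verts G" "v \<in> verts G" for u v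
    using tree_reachable[OF that]
  proof (induction rule: B.reachable_induct)
    case (step v w)
    then have "y v - y' v = y w - y' w"
      using tree_eq by (auto simp: arcs_ends_bidirect)
    then show ?case
      using step.IH by simp
  qed simp
  show ?thesis
  proof (rule PiE_ext[of _ "arcs G"])
    show "s \<in> arcs G \<rightarrow>\<^sub>E UNIV" "s' \<in> arcs G \<rightarrow>\<^sub>E UNIV"
      using ys ys' by (auto simp: dual_tree_solution_def)
    show "s a = s' a" if "a \<in> arcs G" for a
      using eq[OF that] const[of "head G a" "tail G a"] that by simp
  qed
qed

text \<open>Existence and uniqueness of the slack make \<open>tree_slack c\<close> the only
  candidate, so the perturbation argument can work with this explicit formula alone.\<close>

lemma dual_tree_feasible_iff:
  "dual_tree_feasible G c T \<longleftrightarrow> (\<forall>a\<in>arcs G. 0 \<le> tree_slack c a)"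
proof -
  have "(\<exists>y. dual_tree_solution G c T y s) \<longleftrightarrow> s = tree_slack c" for s
    using dual_tree_solution_tree_slack dual_tree_solution_slack_unique by metis
  then show ?thesis
    unfolding dual_tree_feasible_def by (metis (no_types, lifting))
qed

text \<open>The slack is linear in the costs; a change of costs is thus estimated through the slack
  of their difference.\<close>

lemma tree_slack_diff:
  assumes "a \<in> arcs G"
  shows "tree_slack c a - tree_slack d a = tree_slack (\<lambda>e. c e - d e) a"
  using assms
  by (simp add: tree_slack_def tree_potential_def left_diff_distrib sum_subtractf)

text \<open>Off the tree, the slack is \<open>c e\<close> minus a combination of tree costs with
  coefficients in {-1, 0, 1}, being differences of indicator values.\<close>

lemma abs_tree_slack_le:
  assumes "e \<in> arcs G"
  shows "\<bar>tree_slack c e\<bar> \<le> (\<Sum>a\<in>arcs G. \<bar>c a\<bar>)"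
proof (cases "e \<in> T")
  case True
  then show ?thesis
    by (simp add: tree_slack_zero sum_nonneg)
next
  case False
  have "\<bar>tree_potential c (head G e) - tree_potential c (tail G e)\<bar> \<le> (\<Sum>a\<in>T. \<bar>c a\<bar>)"
    unfolding tree_potential_diff
  proof (rule order_trans[OF sum_abs], rule sum_mono)
    show "\<bar>c a * (cut_indicator a (head G e) - cut_indicator a (tail G e))\<bar> \<le> \<bar>c a\<bar>" for a
      by (simp add: cut_indicator_def)
  qed
  then have "\<bar>tree_slack c e\<bar> \<le> \<bar>c e\<bar> + (\<Sum>a\<in>T. \<bar>c a\<bar>)"
    using assms by (simp add: tree_slack_def)
  \<comment> \<open>As \<open>e\<close> lies outside \<open>T\<close>, no cost is counted twice and
    the constant stays 1.\<close>
  also have "\<dots> = (\<Sum>a\<in>insert e T. \<bar>c a\<bar>)"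
    using False finite_tree by simp
  also have "\<dots> \<le> (\<Sum>a\<in>arcs G. \<bar>c a\<bar>)"
    using assms tree_subset by (intro sum_mono2) auto
  finally show ?thesis .
qed

lemma tree_slack_in_Ints:
  assumes "\<And>a. a \<in> arcs G \<Longrightarrow> c a \<in> \<int>" "e \<in> arcs G"
  shows "tree_slack c e \<in> \<int>"
proof -
  have "tree_potential c v \<in> \<int>" for v
    unfolding tree_potential_def cut_indicator_def
    using assms(1) tree_subset by (intro Ints_sum) (auto simp: of_bool_def)
  then show ?thesis
    using assms by (simp add: tree_slack_def)
qed

lemma dual_tree_feasible_perturb:
  assumes int_c: "\<And>a. a \<in> arcs G \<Longrightarrow> c a \<in> \<int>"
    and near: "(\<Sum>a\<in>arcs G. \<bar>c a - c' a\<bar>) \<le> \<epsilon>" and "\<epsilon> < 1"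
    and feasible: "dual_tree_feasible G c' T"
  shows "dual_tree_feasible G c T"
  unfolding dual_tree_feasible_iff
proof
  fix a assume a: "a \<in> arcs G"
  have "\<bar>tree_slack c a - tree_slack c' a\<bar> \<le> \<epsilon>"
    using abs_tree_slack_le[OF a] near unfolding tree_slack_diff[OF a] by (rule order_trans)
  moreover have "0 \<le> tree_slack c' a"
    using feasible a by (simp add: dual_tree_feasible_iff)
  ultimately have "- \<epsilon> \<le> tree_slack c a"
    by linarith
  then show "0 \<le> tree_slack c a"
    using tree_slack_in_Ints[OF int_c a] \<open>\<epsilon> < 1\<close> by (intro of_int_nonneg_if_ge_minus)
qed

end

theorem theorem9:
  fixes G :: "('v, 'e) pre_digraph"
    and b :: "'v \<Rightarrow> int" and c :: "'e \<Rightarrow> int"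
    and b' :: "'v \<Rightarrow> real" and c' :: "'e \<Rightarrow> real"
    and \<epsilon> :: real and T :: "'e set"
  assumes "fin_digraph G" and "Digraph_Component.connected G"
    and "(\<Sum>v\<in>verts G. b v) = 0"
    and "0 < \<epsilon>" and "\<epsilon> < 1"
    and "(\<Sum>v\<in>verts G. \<bar>real_of_int (b v) - b' v\<bar>) \<le> 2 * \<epsilon>"
    and "(\<Sum>a\<in>arcs G. \<bar>real_of_int (c a) - c' a\<bar>) \<le> \<epsilon>"
    and "spanning_tree_arcs G T"
  shows "(primal_tree_feasible G b' T \<longrightarrow> primal_tree_feasible G (\<lambda>v. real_of_int (b v)) T)
    \<and> (dual_tree_feasible G c' T \<longrightarrow> dual_tree_feasible G (\<lambda>a. real_of_int (c a)) T)
    \<and> (optimal_tree G b' c' T \<longrightarrow>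
         optimal_tree G (\<lambda>v. real_of_int (b v)) (\<lambda>a. real_of_int (c a)) T)"
proof -
  interpret tree_digraph G T
    using assms by (simp add: tree_digraph_def tree_digraph_axioms_def)
  have "(\<Sum>v\<in>verts G. real_of_int (b v)) = 0"
    using assms(3) by (simp flip: of_int_sum)
  then have "primal_tree_feasible G (\<lambda>v. real_of_int (b v)) T" if "primal_tree_feasible G b' T"
    by (rule primal_tree_feasible_perturb[of _ b' \<epsilon>]) (use assms(5,6) that in auto)
  moreover have "dual_tree_feasible G (\<lambda>a. real_of_int (c a)) T" if "dual_tree_feasible G c' T"
    by (rule dual_tree_feasible_perturb[of _ c' \<epsilon>]) (use assms(5,7) that in auto)
  ultimately show ?thesis
    by (simp add: optimal_tree_def)
qed

end
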